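(* Let $n\ge 3$ be an integer, let $D_{2n}$ be the dihedral group of order $2n$, and let $\Gamma_{D_{2n}}$ be its non-commuting graph. Write spectra as two-row arrays with eigenvalues in the first row and their multiplicities in the second row. (1) If $n$ is even and $n>4$, then $$\mathrm{spec}(\Gamma_{D_{2n}})=\begin{pmatrix} -2 & 0 & \frac{(n-2)-\sqrt{5n^{2}-12n+4}}{2} & \frac{(n-2)+\sqrt{5n^{2}-12n+4}}{2}\\ \frac{n}{2}-1 & \frac{3n}{2}-3 & 1 & 1\end{pmatrix}.$$ (2) If $n$ is odd, then $$\mathrm{spec}(\Gamma_{D_{2n}})=\begin{pmatrix} -1 & 0 & \frac{(n-1)-\sqrt{5n^{2}-6n+1}}{2} & \frac{(n-1)+\sqrt{5n^{2}-6n+1}}{2}\\ n-1 & n-2 & 1 & 1\end{pmatrix}.$$ (3) If $n=4$, then $$\mathrm{spec}(\Gamma_{D_{2n}})=\begin{pmatrix} -2 & 0 & 4\\ 2 & 3 & 1\end{pmatrix}.$$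
   Context: For a finite non-abelian group $G$ with center $Z(G)$, the non-commuting graph $\Gamma_G=\Gamma(G)$ is the simple graph with vertex set $G\setminus Z(G)$ in which two vertices $x,y$ are adjacent if and only if $xy\ne yx$. The spectrum $\mathrm{spec}(\Gamma)$ of a graph is the multiset of eigenvalues of its $(0,1)$ adjacency matrix, with multiplicities. *)

theory Defs
  imports
    "HOL-Algebra.Group"
    "Graph_Theory.Pair_Digraph"
    "Jordan_Normal_Form.Char_Poly"
begin

definition group_center :: "('a, 'b) monoid_scheme \<Rightarrow> 'a set" where
  "group_center G = {z \<in> carrier G. \<forall>x\<in>carrier G. z \<otimes>\<^bsub>G\<^esub> x = x \<otimes>\<^bsub>G\<^esub> z}"

text \<open>Simple graphs are symmetric loop-free digraphs (locale \<^locale>\<open>pair_graph\<close>): an edge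
  is represented by its two opposite arcs.\<close>

definition noncommuting_graph :: "('a, 'b) monoid_scheme \<Rightarrow> 'a pair_pre_digraph" where
  "noncommuting_graph G =
    \<lparr> pverts = carrier G - group_center G,
      parcs = {(x, y). x \<in> carrier G - group_center G \<and> y \<in> carrier G - group_center G \<and>
                       x \<otimes>\<^bsub>G\<^esub> y \<noteq> y \<otimes>\<^bsub>G\<^esub> x} \<rparr>"

lemma pair_graph_noncommuting_graph:
  assumes "finite (carrier G)"
  shows "pair_graph (noncommuting_graph G)"
proof -
  have "parcs (noncommuting_graph G) \<subseteq> carrier G \<times> carrier G"
    by (auto simp: noncommuting_graph_def)
  then have fin: "finite (parcs (noncommuting_graph G))"
    using assms finite_subset by blast
  show ?thesis
    by (unfold_locales; (unfold symmetric_def arcs_ends_def arc_to_ends_def)?)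
      (use assms fin in \<open>auto simp: noncommuting_graph_def with_proj_def intro!: symI\<close>)
qed

text \<open>The adjacency matrix is taken with respect to an enumeration \<open>vs\<close> of the vertices.\<close>

definition adjacency_matrix :: "'a pair_pre_digraph \<Rightarrow> 'a list \<Rightarrow> real mat" where
  "adjacency_matrix \<Gamma> vs =
    mat (length vs) (length vs) (\<lambda>(i, j). if (vs ! i, vs ! j) \<in> parcs \<Gamma> then 1 else 0)"

text \<open>Multiplicities are orders as roots of the characteristic polynomial. For a finite simple
  graph the matrix is real symmetric, so all its complex eigenvalues are real and these
  multiplicities are also the dimensions of the eigenspaces. The choice of the enumeration
  is immaterial, see \<open>graph_spectrum_eq\<close> below.\<close>

definition graph_spectrum :: "'a pair_pre_digraph \<Rightarrow> real multiset" where
  "graph_spectrum \<Gamma> =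
    proots (char_poly (adjacency_matrix \<Gamma> (SOME vs. distinct vs \<and> set vs = pverts \<Gamma>)))"

lemma char_poly_adjacency_matrix_cong:
  assumes "distinct vs" "distinct ws" "set vs = set ws"
  shows "char_poly (adjacency_matrix \<Gamma> vs) = char_poly (adjacency_matrix \<Gamma> ws)"
proof -
  define n where "n = length ws"
  have "mset vs = mset ws"
    using assms by (simp add: set_eq_iff_mset_eq_distinct)
  then obtain p where p: "p permutes {..<length ws}" and vs: "permute_list p ws = vs"
    by (rule mset_eq_permutation)
  have p': "p permutes {0..<n}"
    using p by (simp add: n_def atLeast0LessThan)
  have len: "length vs = n"
    using vs by (auto simp: n_def)
  define A where "A = char_poly_matrix (adjacency_matrix \<Gamma> ws)"
  define B where "B = mat n n (\<lambda>(i, j). A $$ (p i, j))"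
  have A: "A \<in> carrier_mat n n"
    by (simp add: A_def n_def adjacency_matrix_def)
  have B: "B \<in> carrier_mat n n"
    by (simp add: B_def)
  have lt: "p i < n" if "i < n" for i
    using permutes_in_image[OF p', of i] that by simp
  have nth: "vs ! i = ws ! p i" if "i < n" for i
    using that p vs permute_list_nth n_def by blast
  have inj: "p i = p j \<longleftrightarrow> i = j" for i j
    using permutes_inj[OF p'] by (auto dest: injD)
  have eq: "char_poly_matrix (adjacency_matrix \<Gamma> vs) =
      transpose_mat (mat n n (\<lambda>(i, j). transpose_mat B $$ (p i, j)))"
    by (rule eq_matI)
      (auto simp: A_def B_def char_poly_matrix_def adjacency_matrix_def len n_def[symmetric]
        lt nth inj)
  have "det (char_poly_matrix (adjacency_matrix \<Gamma> vs)) = signof p * det (transpose_mat B)"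
    unfolding eq using B
    by (subst det_transpose[of _ n]) (simp_all add: det_permute_rows[OF _ p'])
  also have "det (transpose_mat B) = signof p * det A"
    using det_permute_rows[OF A p'] det_transpose[OF B] by (simp add: B_def)
  also have "signof p * (signof p * det A) = det A"
    by (simp add: sign_def)
  finally show ?thesis
    by (simp add: char_poly_def A_def)
qed

lemma graph_spectrum_eq:
  assumes "distinct vs" "set vs = pverts \<Gamma>"
  shows "graph_spectrum \<Gamma> = proots (char_poly (adjacency_matrix \<Gamma> vs))"
proof -
  have "\<exists>ws. distinct ws \<and> set ws = pverts \<Gamma>"
    using assms by blast
  from someI_ex[OF this] show ?thesis
    unfolding graph_spectrum_def
    using char_poly_adjacency_matrix_cong[of _ vs \<Gamma>] assms by (metis (no_types, lifting))
qed

text \<open>With \<open>r\<close> the rotation of order \<open>n\<close> and \<open>s\<close> a reflection, \<open>(i, a)\<close> stands for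
  \<open>r ^ i * s ^ a\<close>, where \<open>s * r ^ i = r ^ (-i) * s\<close>.\<close>

definition dihedral_group :: "nat \<Rightarrow> (int \<times> bool) monoid" where
  "dihedral_group n =
    \<lparr> carrier = {0..<int n} \<times> UNIV,
      monoid.mult = (\<lambda>(i, a) (j, b). ((if a then i - j else i + j) mod int n, a \<noteq> b)),
      one = (0, False) \<rparr>"

lemma group_dihedral_group:
  assumes "n \<ge> 1"
  shows "group (dihedral_group n)"
proof (rule groupI)
  fix x assume "x \<in> carrier (dihedral_group n)"
  then obtain i a where x: "x = (i, a)" "0 \<le> i" "i < int n"
    by (auto simp: dihedral_group_def)
  let ?y = "(if a then i else (- i) mod int n, a)"
  have "?y \<in> carrier (dihedral_group n)"
    using x assms by (auto simp: dihedral_group_def)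
  moreover have "?y \<otimes>\<^bsub>dihedral_group n\<^esub> x = \<one>\<^bsub>dihedral_group n\<^esub>"
    using x by (auto simp: dihedral_group_def mod_simps)
  ultimately show "\<exists>y\<in>carrier (dihedral_group n).
      y \<otimes>\<^bsub>dihedral_group n\<^esub> x = \<one>\<^bsub>dihedral_group n\<^esub>"
    by blast
qed (use assms in \<open>auto simp: dihedral_group_def mod_simps algebra_simps split: if_splits\<close>)

lemma card_carrier_dihedral_group: "card (carrier (dihedral_group n)) = 2 * n"
  by (simp add: dihedral_group_def card_cartesian_product)

end

theory Submission
  imports Defs
begin

text \<open>With \<open>c = gcd n 2\<close> and \<open>k = n div c\<close>, two reflections of the dihedral group commute iff their
  indices agree modulo \<open>k\<close>, while a non-central rotation commutes with no reflection. Hence the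
  non-commuting graph is complete multipartite with one part of size \<open>n - c\<close> and \<open>k\<close> parts of size
  \<open>c\<close>. The adjacency matrix of a complete multipartite graph factors through the incidence matrix
  of vertices and parts, so Sylvester's determinant identity reduces its characteristic polynomial
  to the determinant of a rank-one perturbation of a diagonal matrix indexed by the parts.\<close>

section \<open>Determinant identities\<close>

text \<open>Sylvester's identity, from computing the determinant of one block matrix
  \<open>M\<close> twice. Multiplying by \<open>L\<close> on the left or by \<open>R\<close> on the
  right clears the upper right block and leaves one of the two sums on the diagonal. Keeping the
  powers of \<open>x\<close> on both sides avoids division, so the identity also covers
  \<open>x = 0\<close>.\<close>

lemma det_smult_one_add_mult_commute:
  fixes U :: "'a :: idom mat"
  assumes U: "U \<in> carrier_mat N p" and V: "V \<in> carrier_mat p N"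
  shows "x ^ p * det (x \<cdot>\<^sub>m 1\<^sub>m N + U * V) = x ^ N * det (x \<cdot>\<^sub>m 1\<^sub>m p + V * U)"
proof -
  define M where "M = four_block_mat (x \<cdot>\<^sub>m 1\<^sub>m N) (- U) V (1\<^sub>m p)"
  define L where "L = four_block_mat (1\<^sub>m N) U (0\<^sub>m p N) (1\<^sub>m p)"
  define R where "R = four_block_mat (1\<^sub>m N) U (0\<^sub>m p N) (x \<cdot>\<^sub>m 1\<^sub>m p)"
  have M: "M \<in> carrier_mat (N + p) (N + p)" and L: "L \<in> carrier_mat (N + p) (N + p)"
    and R: "R \<in> carrier_mat (N + p) (N + p)"
    unfolding M_def L_def R_def by auto
  have "L * M = four_block_mat (x \<cdot>\<^sub>m 1\<^sub>m N + U * V) (0\<^sub>m N p) V (1\<^sub>m p)"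
    unfolding L_def M_def using U V
    by (subst mult_four_block_mat[where ?nr1.0 = N and ?n1.0 = N and ?n2.0 = p and ?nr2.0 = p
          and ?nc1.0 = N and ?nc2.0 = p]) auto
  then have "det L * det M = det (x \<cdot>\<^sub>m 1\<^sub>m N + U * V)"
    using U V by (subst det_mult[symmetric, OF L M])
      (auto simp: det_four_block_mat_upper_right_zero[where n = N and m = p])
  moreover have "det L = 1"
    unfolding L_def using U
    by (subst det_four_block_mat_lower_left_zero[where n = N and m = p]) auto
  moreover have "M * R = four_block_mat (x \<cdot>\<^sub>m 1\<^sub>m N) (0\<^sub>m N p) V (x \<cdot>\<^sub>m 1\<^sub>m p + V * U)"
  proof -
    \<comment> \<open>The upper right block of \<open>M * R\<close>; the scalar \<open>x\<close> in
      the last block of \<open>R\<close> is there to make it cancel.\<close>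
    have "x \<cdot>\<^sub>m 1\<^sub>m N * U = x \<cdot>\<^sub>m U" "- U * (x \<cdot>\<^sub>m 1\<^sub>m p) = x \<cdot>\<^sub>m (- U)"
      using U mult_smult_assoc_mat[of "1\<^sub>m N" N N U p x] mult_smult_distrib[of "- U" N p "1\<^sub>m p" p x]
      by auto
    moreover have "x \<cdot>\<^sub>m U + x \<cdot>\<^sub>m (- U) = 0\<^sub>m N p"
      using U by (intro eq_matI) auto
    ultimately have "x \<cdot>\<^sub>m 1\<^sub>m N * U + - U * (x \<cdot>\<^sub>m 1\<^sub>m p) = 0\<^sub>m N p"
      by simp
    moreover have "V * U + 1\<^sub>m p * (x \<cdot>\<^sub>m 1\<^sub>m p) = x \<cdot>\<^sub>m 1\<^sub>m p + V * U"
      using U V by (subst left_mult_one_mat[where nr = p and nc = p]) (auto intro!: comm_add_mat)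
    ultimately show ?thesis
      unfolding R_def M_def using U V
      by (subst mult_four_block_mat[where ?nr1.0 = N and ?n1.0 = N and ?n2.0 = p and ?nr2.0 = p
            and ?nc1.0 = N and ?nc2.0 = p]) auto
  qed
  then have "det M * det R = x ^ N * det (x \<cdot>\<^sub>m 1\<^sub>m p + V * U)"
    using U V by (subst det_mult[symmetric, OF M R])
      (auto simp: det_four_block_mat_upper_right_zero[where n = N and m = p])
  moreover have "det R = x ^ p"
    unfolding R_def using U
    by (subst det_four_block_mat_lower_left_zero[where n = N and m = p]) auto
  ultimately show ?thesis
    by (simp add: mult.commute)
qed

text \<open>Factoring out the diagonal matrix \<open>D\<close> leaves the identity plus a column
  times a row. Sylvester's identity at 1 with inner dimension 1 turns the remaining determinant into
  that of a 1 by 1 matrix.\<close>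

lemma det_diagonal_add_rank_one:
  fixes d u v :: "nat \<Rightarrow> 'a :: field"
  assumes d: "\<And>i. i < p \<Longrightarrow> d i \<noteq> 0"
  shows "det (mat p p (\<lambda>(i, j). (if i = j then d i else 0) + u i * v j)) =
    (\<Prod>i<p. d i) * (1 + (\<Sum>i<p. u i * v i / d i))"
proof -
  define D where "D = mat p p (\<lambda>(i, j). if i = j then d i else 0)"
  define U where "U = mat p 1 (\<lambda>(i, j :: nat). u i / d i)"
  define V where "V = mat 1 p (\<lambda>(i :: nat, j). v j)"
  have D: "D \<in> carrier_mat p p" and U: "U \<in> carrier_mat p 1" and V: "V \<in> carrier_mat 1 p"
    by (auto simp: D_def U_def V_def)
  have "(D * X) $$ (i, j) = d i * X $$ (i, j)" if "X \<in> carrier_mat p p" "i < p" "j < p" for X i j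
  proof -
    have "(D * X) $$ (i, j) = (\<Sum>l = 0..<p. if l = i then d i * X $$ (i, j) else 0)"
      using that by (auto simp: D_def scalar_prod_def simp del: sum.delta sum.delta' intro!: sum.cong)
    then show ?thesis
      using that by simp
  qed
  moreover have "(U * V) $$ (i, j) = u i / d i * v j" if "i < p" "j < p" for i j
    using that by (simp add: U_def V_def scalar_prod_def)
  ultimately have "mat p p (\<lambda>(i, j). (if i = j then d i else 0) + u i * v j) =
      D * (1 \<cdot>\<^sub>m 1\<^sub>m p + U * V)"
    using D U V d by (intro eq_matI) (auto simp: distrib_left simp del: index_mult_mat(1))
  moreover have "det D = (\<Prod>i<p. d i)"
    using D by (subst det_upper_triangular)
      (auto simp: D_def diag_mat_def prod.list_conv_set_nth atLeast0LessThan intro!: upper_triangularI)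
  moreover have "det (1 \<cdot>\<^sub>m 1\<^sub>m 1 + V * U) = 1 + (\<Sum>i<p. u i * v i / d i)"
    by (subst det_single) (auto simp: U_def V_def scalar_prod_def atLeast0LessThan ac_simps)
  ultimately show ?thesis
    using det_smult_one_add_mult_commute[OF U V, of 1] D U V by (simp add: det_mult)
qed

section \<open>Spectrum of a complete multipartite graph\<close>

text \<open>The adjacency matrix is \<open>- (U * V)\<close> with \<open>U\<close> the incidence
  matrix of vertices and parts, so the determinant of size \<open>N\<close> is traded for one of
  size \<open>p\<close>, which is a diagonal matrix plus a rank-one matrix. The hypothesis on
  \<open>x\<close> makes the diagonal invertible.\<close>

lemma poly_char_poly_complete_multipartite:
  fixes f :: "nat \<Rightarrow> nat" and x :: real
  assumes f: "\<And>i. i < N \<Longrightarrow> f i < p"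
    and x: "\<And>l. l < p \<Longrightarrow> x + real (card {i. i < N \<and> f i = l}) \<noteq> 0"
  shows "x ^ p * poly (char_poly (mat N N (\<lambda>(i, j). if f i \<noteq> f j then 1 else 0))) x =
    x ^ N * (\<Prod>l<p. x + real (card {i. i < N \<and> f i = l})) *
      (1 - (\<Sum>l<p. real (card {i. i < N \<and> f i = l}) / (x + real (card {i. i < N \<and> f i = l}))))"
proof -
  define c where "c l = real (card {i. i < N \<and> f i = l})" for l
  define A where "A = mat N N (\<lambda>(i, j). if f i \<noteq> f j then 1 else (0 :: real))"
  define U where "U = mat N p (\<lambda>(i, l). if f i = l then 1 else (0 :: real))"
  \<comment> \<open>\<open>V\<close> is the transpose of \<open>U\<close> minus the all-ones matrix.
    Each row of \<open>U\<close> has a single 1, hence \<open>U * V\<close> is the same-part matrix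
    minus the all-ones matrix, that is, \<open>- A\<close>.\<close>
  define V where "V = mat p N (\<lambda>(l, j). (if f j = l then 1 else 0) - (1 :: real))"
  have A: "A \<in> carrier_mat N N" and U: "U \<in> carrier_mat N p" and V: "V \<in> carrier_mat p N"
    by (auto simp: A_def U_def V_def)
  have c: "(\<Sum>i = 0..<N. if f i = l then 1 else 0) = c l" for l
    by (simp add: c_def sum.If_cases Int_def)
  have "(U * V) $$ (i, j) = - A $$ (i, j)" if "i < N" "j < N" for i j
  proof -
    have "(U * V) $$ (i, j) = (\<Sum>l = 0..<p. if l = f i then - A $$ (i, j) else 0)"
      using that f[of i]
      by (auto simp: A_def U_def V_def scalar_prod_def simp del: sum.delta sum.delta'
          intro!: sum.cong)
    then show ?thesis
      using f that by simp
  qed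
  then have "- char_matrix A x = x \<cdot>\<^sub>m 1\<^sub>m N + U * V"
    using A U V by (intro eq_matI) (auto simp: char_matrix_def simp del: index_mult_mat(1))
  \<comment> \<open>The transpose of \<open>U\<close> times \<open>U\<close> is the diagonal matrix
    of part sizes, and the all-ones matrix times \<open>U\<close> has the vector of part sizes as
    every row.\<close>
  moreover have "x \<cdot>\<^sub>m 1\<^sub>m p + V * U =
      mat p p (\<lambda>(l, m). (if l = m then x + c l else 0) + (- 1) * c m)"
  proof (rule eq_matI)
    fix l m assume "l < dim_row (mat p p (\<lambda>(l, m). (if l = m then x + c l else 0) + (- 1) * c m))"
      "m < dim_col (mat p p (\<lambda>(l, m). (if l = m then x + c l else 0) + (- 1) * c m))"
    then have lm: "l < p" "m < p" by auto
    have "(V * U) $$ (l, m) = (\<Sum>i = 0..<N. (if l = m then (if f i = m then 1 else 0) else 0)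
        - (if f i = m then 1 else 0))"
      using lm
      by (auto simp: U_def V_def scalar_prod_def simp del: sum.delta sum.delta' intro!: sum.cong)
    also have "\<dots> = (if l = m then c m else 0) - c m"
      by (auto simp: sum_subtractf c)
    finally show "(x \<cdot>\<^sub>m 1\<^sub>m p + V * U) $$ (l, m) =
        mat p p (\<lambda>(l, m). (if l = m then x + c l else 0) + (- 1) * c m) $$ (l, m)"
      using lm U V by auto
  qed (use U V in auto)
  ultimately have "x ^ p * poly (char_poly A) x =
      x ^ N * det (mat p p (\<lambda>(l, m). (if l = m then x + c l else 0) + (- 1) * c m))"
    using det_smult_one_add_mult_commute[OF U V, of x] by (simp only: char_poly_matrix[OF A])
  also have "det (mat p p (\<lambda>(l, m). (if l = m then x + c l else 0) + (- 1) * c m)) =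
      (\<Prod>l<p. x + c l) * (1 + (\<Sum>l<p. (- 1) * c l / (x + c l)))"
    using x by (intro det_diagonal_add_rank_one) (simp add: c_def)
  also have "(\<Sum>l<p. (- 1) * c l / (x + c l)) = - (\<Sum>l<p. c l / (x + c l))"
    by (simp add: sum_negf)
  finally show ?thesis
    by (simp only: A_def c_def mult.assoc add_uminus_conv_diff)
qed

text \<open>The characteristic polynomial is \<open>x ^ (m - 1 + k * (c - 1))\<close> times
  \<open>(x + c) ^ (k - 1)\<close> times a quadratic. The hypotheses on \<open>a\<close> and
  \<open>b\<close> are Vieta's relations for that quadratic, which keeps square roots out of the
  argument.\<close>

lemma graph_spectrum_complete_multipartite:
  fixes \<Gamma> :: "'a pair_pre_digraph" and part :: "'a \<Rightarrow> nat" and a b :: real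
  assumes fin: "finite (pverts \<Gamma>)"
    and adj: "\<And>v w. v \<in> pverts \<Gamma> \<Longrightarrow> w \<in> pverts \<Gamma> \<Longrightarrow>
      (v, w) \<in> parcs \<Gamma> \<longleftrightarrow> part v \<noteq> part w"
    and part: "\<And>v. v \<in> pverts \<Gamma> \<Longrightarrow> part v \<le> k"
    and card_0: "card {v \<in> pverts \<Gamma>. part v = 0} = m"
    and card_Suc: "\<And>l. l < k \<Longrightarrow> card {v \<in> pverts \<Gamma>. part v = Suc l} = c"
    and pos: "m > 0" "c > 0" "k > 0"
    and sum_roots: "a + b = real c * (real k - 1)"
    and prod_roots: "a * b = - (real m * real c * real k)"
  shows "graph_spectrum \<Gamma> = replicate_mset (k - 1) (- real c) +
    replicate_mset (m - 1 + k * (c - 1)) 0 + {#a, b#}"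
proof -
  obtain vs where vs: "distinct vs" "set vs = pverts \<Gamma>"
    using finite_distinct_list[OF fin] by blast
  define N where "N = length vs"
  define f where "f i = part (vs ! i)" for i
  have f: "f i < Suc k" if "i < N" for i
    using that part[of "vs ! i"] vs(2) nth_mem[of i vs] by (simp add: N_def f_def less_Suc_eq_le)
  have card_f: "card {i. i < N \<and> f i = l} = card {v \<in> pverts \<Gamma>. part v = l}" for l
  proof (rule bij_betw_same_card)
    show "bij_betw ((!) vs) {i. i < N \<and> f i = l} {v \<in> pverts \<Gamma>. part v = l}"
      using vs by (auto simp: bij_betw_def N_def f_def inj_on_def nth_eq_iff_index_eq in_set_conv_nth
          simp flip: vs(2))
  qed
  \<comment> \<open>Vertices are counted part by part.\<close>
  have "N = (\<Sum>l<Suc k. card {i. i < N \<and> f i = l})"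
    using sum.group[of "{..<N}" "{..<Suc k}" f "\<lambda>_. 1 :: nat"] f
    by (auto simp: image_subset_iff)
  then have N: "N = m + k * c"
    by (subst (asm) sum.lessThan_Suc_shift) (simp add: card_f card_0 card_Suc)
  have adjacency: "adjacency_matrix \<Gamma> vs = mat N N (\<lambda>(i, j). if f i \<noteq> f j then 1 else 0)"
    unfolding adjacency_matrix_def N_def[symmetric]
    by (rule cong_mat) (use adj nth_mem[of _ vs] in \<open>auto simp: f_def N_def vs(2)\<close>)
  define q :: "real poly" where
    "q = [:0, 1:] ^ (m - 1 + k * (c - 1)) * [:real c, 1:] ^ (k - 1) * [:- a, 1:] * [:- b, 1:]"
  \<comment> \<open>For positive \<open>x\<close> every \<open>x + c l\<close> is nonzero, and the
    power of \<open>x\<close> on both sides can be cancelled.\<close>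
  have "poly (char_poly (adjacency_matrix \<Gamma> vs)) x = poly q x" if "x > 0" for x
  proof -
    \<comment> \<open>Writing the sizes as successors removes the truncated subtractions from the
      exponents of \<open>q\<close>.\<close>
    obtain m' c' k' where Suc: "m = Suc m'" "c = Suc c'" "k = Suc k'"
      using pos by (metis gr0_implies_Suc)
    have exps: "N = Suc k + (m' + k * c')"
      using N Suc by simp
    have size: "card {i. i < N \<and> f i = l} = (if l = 0 then m else c)" if "l < Suc k" for l
      using that by (cases l) (simp_all add: card_f card_0 card_Suc)
    have pos': "x + real m > 0" "x + real c > 0"
      using that by auto
    have "(x - a) * (x - b) = x\<^sup>2 - (a + b) * x + a * b"
      by (simp add: algebra_simps power2_eq_square)
    then have quad: "(x - a) * (x - b) = x\<^sup>2 - real c * (real k - 1) * x - real m * real c * real k"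
      by (simp add: sum_roots prod_roots)
    have "x ^ Suc k * poly (char_poly (adjacency_matrix \<Gamma> vs)) x =
        x ^ N * (\<Prod>l<Suc k. x + real (if l = 0 then m else c)) *
          (1 - (\<Sum>l<Suc k. real (if l = 0 then m else c) / (x + real (if l = 0 then m else c))))"
      unfolding adjacency using pos' poly_char_poly_complete_multipartite[of N f "Suc k" x, OF f]
      by (simp add: size del: prod.lessThan_Suc sum.lessThan_Suc power_Suc)
    also have "(\<Prod>l<Suc k. x + real (if l = 0 then m else c)) = (x + real m) * (x + real c) ^ k"
      by (subst prod.lessThan_Suc_shift) simp
    also have "(\<Sum>l<Suc k. real (if l = 0 then m else c) / (x + real (if l = 0 then m else c))) =
        real m / (x + real m) + real k * (real c / (x + real c))"
      by (subst sum.lessThan_Suc_shift) simp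
    \<comment> \<open>Of the \<open>k\<close> factors \<open>x + c\<close>, one is split off to
      clear denominators together with \<open>x + m\<close>; the other \<open>k'\<close> give the
      eigenvalue \<open>- c\<close>.\<close>
    also have "x ^ N * ((x + real m) * (x + real c) ^ k) *
        (1 - (real m / (x + real m) + real k * (real c / (x + real c)))) =
        x ^ N * (x + real c) ^ k' * ((x + real m) * (x + real c) *
          (1 - (real m / (x + real m) + real k * (real c / (x + real c)))))"
      by (simp only: Suc(3) power_Suc mult_ac)
    also have "(x + real m) * (x + real c) *
        (1 - (real m / (x + real m) + real k * (real c / (x + real c)))) =
        (x + real m) * (x + real c) - real m * (x + real c) - real k * real c * (x + real m)"
    proof -
      have "u * v * (1 - (r / u + s * (t / v))) = u * v - r * v - s * t * u"
        if "u \<noteq> 0" "v \<noteq> 0" for u v r s t :: real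
        using that by (simp add: field_simps)
      then show ?thesis
        using pos' by simp
    qed
    also have "\<dots> = (x - a) * (x - b)"
      unfolding quad by (simp add: algebra_simps power2_eq_square)
    also have "x ^ N * (x + real c) ^ k' * ((x - a) * (x - b)) = x ^ Suc k * poly q x"
    proof -
      have "poly q x = x ^ (m' + k * c') * (x + real c) ^ k' * (x - a) * (x - b)"
        unfolding q_def poly_mult poly_power by (simp add: Suc add.commute)
      then show ?thesis
        unfolding exps power_add by (simp only: mult_ac)
    qed
    finally show ?thesis
      using that by simp
  qed
  \<comment> \<open>Two polynomials that agree at infinitely many points are equal.\<close>
  then have "{0<..} \<subseteq> {x. poly (char_poly (adjacency_matrix \<Gamma> vs) - q) x = 0}"
    by auto
  then have "char_poly (adjacency_matrix \<Gamma> vs) = q"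
    using poly_roots_finite[of "char_poly (adjacency_matrix \<Gamma> vs) - q"] finite_subset
      infinite_Ioi[of "0 :: real"] by auto
  then show ?thesis
    using graph_spectrum_eq[OF vs] 
    by (simp add: q_def proots_mult proots_power no_zero_divisors del: mult_pCons_left mult_pCons_right)
qed

section \<open>Non-commuting graphs of dihedral groups\<close>

text \<open>Division with remainder: \<open>q\<close> maps to \<open>q * k + r\<close>, with inverse
  \<open>i div k\<close>.\<close>

lemma card_residue_class:
  fixes k c r :: nat
  assumes "r < k"
  shows "card {i \<in> {0..<int (c * k)}. i mod int k = int r} = c"
proof -
  have "q * k + r < c * k" if "q < c" for q
    using assms that mult_le_mono1[of "Suc q" c k] by simp
  moreover have "nat (i div int k) < c" if "0 \<le> i" "i < int (c * k)" for i
    using that less_mult_imp_div_less[of "nat i" c k] by (simp add: nat_div_distrib nat_less_iff)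
  moreover have "int (nat (i div int k)) * int k + int r = i" if "0 \<le> i" "i mod int k = int r" for i
    using that assms div_mult_mod_eq[of i "int k"] by (simp add: pos_imp_zdiv_nonneg_iff)
  ultimately have
    "bij_betw (\<lambda>q. int (q * k + r)) {..<c} {i \<in> {0..<int (c * k)}. i mod int k = int r}"
    using assms
    by (intro bij_betw_byWitness[where f' = "\<lambda>i. nat (i div int k)"])
      (auto simp: mod_mult_self1 nat_div_distrib simp flip: of_nat_add of_nat_mult of_nat_mod zdiv_int)
  then show ?thesis
    using bij_betw_same_card by fastforce
qed

text \<open>Treats both parities at once: the hypothesis \<open>dvd\<close> holds with
  \<open>c = 2\<close> for even \<open>n\<close> and with \<open>c = 1\<close> for odd
  \<open>n\<close>. The conditions on \<open>a\<close> and \<open>b\<close> are the Vieta relations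
  for one part of size \<open>n - c\<close> and \<open>k\<close> parts of size \<open>c\<close>,
  simplified by \<open>c * k = n\<close>.\<close>

lemma graph_spectrum_noncommuting_graph_dihedral_group:
  fixes n c k :: nat and a b :: real
  assumes n: "n = c * k" and "c < n" "c > 0" "n \<ge> 3"
    and dvd: "\<And>d. int n dvd 2 * d \<longleftrightarrow> int k dvd d"
    and sum_roots: "a + b = real n - real c"
    and prod_roots: "a * b = - ((real n - real c) * real n)"
  shows "graph_spectrum (noncommuting_graph (dihedral_group n)) =
    replicate_mset (k - 1) (- real c) + replicate_mset (n - c - 1 + k * (c - 1)) 0 + {#a, b#}"
proof -
  let ?G = "dihedral_group n" and ?\<Gamma> = "noncommuting_graph (dihedral_group n)"
  \<comment> \<open>All non-central rotations share the label 0; a reflection is labelled by the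
    successor of its index modulo \<open>k\<close>.\<close>
  define part where "part = (\<lambda>(i :: int, s). if s then Suc (nat (i mod int k)) else 0)"
  have k: "k > 0"
    using n \<open>n \<ge> 3\<close> by (cases k) auto
  have carrier: "carrier ?G = {0..<int n} \<times> UNIV"
    by (simp add: dihedral_group_def)
  have commute: "(i, s) \<otimes>\<^bsub>?G\<^esub> (j, t) = (j, t) \<otimes>\<^bsub>?G\<^esub> (i, s) \<longleftrightarrow>
      (if s then if t then int k dvd i - j else int k dvd j else t \<longrightarrow> int k dvd i)" for i j s t
  proof -
    \<comment> \<open>The differences of the rotation indices of the two products, for two
      reflections, for a reflection and a rotation, and for a rotation and a reflection. Each is
      twice some integer up to sign, so \<open>dvd\<close> turns divisibility by \<open>n\<close>
      into divisibility by \<open>k\<close>.\<close>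
    have "i - j - (j - i) = 2 * (i - j)" "i - j - (j + i) = - (2 * j)" "i + j - (j - i) = 2 * i"
      by simp_all
    then show ?thesis
      using dvd[of "i - j"] dvd[of j] dvd[of i]
      by (simp add: dihedral_group_def mod_eq_dvd_iff add.commute del: right_diff_distrib_numeral)
  qed
  \<comment> \<open>As \<open>n\<close> does not divide 2, the rotation by one step commutes with no
    reflection; hence no reflection is central.\<close>
  have not_dvd: "\<not> int k dvd 1"
    using dvd[of 1] \<open>n \<ge> 3\<close> zdvd_imp_le[of "int n" 2] by auto
  have center: "group_center ?G = {(i, s). i \<in> {0..<int n} \<and> \<not> s \<and> int k dvd i}"
  proof -
    have "(i, True) \<notin> group_center ?G" for i
    proof
      assume "(i, True) \<in> group_center ?G"
      moreover have "(1, False) \<in> carrier ?G"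
        using \<open>n \<ge> 3\<close> by (simp add: carrier)
      ultimately have "(i, True) \<otimes>\<^bsub>?G\<^esub> (1, False) = (1, False) \<otimes>\<^bsub>?G\<^esub> (i, True)"
        unfolding group_center_def by blast
      then show False
        using not_dvd by (simp add: commute)
    qed
    moreover have "(i, False) \<in> group_center ?G \<longleftrightarrow> i \<in> {0..<int n} \<and> int k dvd i" for i
      using \<open>n \<ge> 3\<close> by (auto simp: group_center_def carrier commute)
    ultimately show ?thesis
      by (auto split: prod.splits) (metis (full_types))+
  qed
  have verts: "pverts ?\<Gamma> = {(i, s). i \<in> {0..<int n} \<and> (s \<or> \<not> int k dvd i)}"
    by (auto simp: noncommuting_graph_def center carrier)
  show ?thesis
  proof (rule graph_spectrum_complete_multipartite[where part = part and k = k and c = c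
        and m = "n - c" and a = a and b = b])
    show "finite (pverts ?\<Gamma>)"
      by (simp add: noncommuting_graph_def carrier)
    show "(v, w) \<in> parcs ?\<Gamma> \<longleftrightarrow> part v \<noteq> part w"
      if "v \<in> pverts ?\<Gamma>" "w \<in> pverts ?\<Gamma>" for v w
    proof -
      obtain i s j t where vw: "v = (i, s)" "w = (j, t)" by fastforce
      have "(v, w) \<in> parcs ?\<Gamma> \<longleftrightarrow> v \<otimes>\<^bsub>?G\<^esub> w \<noteq> w \<otimes>\<^bsub>?G\<^esub> v"
        using that by (simp add: noncommuting_graph_def)
      moreover have "nat (i mod int k) = nat (j mod int k) \<longleftrightarrow> int k dvd i - j"
        using k by (simp add: eq_nat_nat_iff mod_eq_dvd_iff)
      ultimately show ?thesis
        using that unfolding verts vw by (auto simp: commute part_def)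
    qed
    show "part v \<le> k" for v
      using k by (auto simp: part_def Suc_le_eq nat_less_iff split: prod.split)
    \<comment> \<open>The central rotations are the residue class of 0 modulo \<open>k\<close>,
      which has \<open>c\<close> of the \<open>n\<close> rotation indices.\<close>
    have rotations: "{v \<in> pverts ?\<Gamma>. part v = 0} =
        ({0..<int n} - {i \<in> {0..<int (c * k)}. i mod int k = int 0}) \<times> {False}"
      by (auto simp: verts part_def mod_eq_0_iff_dvd n[symmetric] simp del: of_nat_mult
          split: if_splits)
    show "card {v \<in> pverts ?\<Gamma>. part v = 0} = n - c"
    proof -
      have "finite {i \<in> {0..<int (c * k)}. i mod int k = int 0}"
        by (rule finite_subset[of _ "{0..<int (c * k)}"]) auto
      then have "card ({0..<int n} - {i \<in> {0..<int (c * k)}. i mod int k = int 0}) =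
          card {0..<int n} - card {i \<in> {0..<int (c * k)}. i mod int k = int 0}"
        by (rule card_Diff_subset) (auto simp: n)
      then show ?thesis
        unfolding rotations card_cartesian_product card_residue_class[OF k] by simp
    qed
    show "card {v \<in> pverts ?\<Gamma>. part v = Suc l} = c" if "l < k" for l
    proof -
      have "{v \<in> pverts ?\<Gamma>. part v = Suc l} =
          {i \<in> {0..<int (c * k)}. i mod int k = int l} \<times> {True}"
        using k
        by (auto simp: verts part_def n[symmetric] simp del: of_nat_mult split: if_splits)
      then show ?thesis
        using card_residue_class[OF that, of c] by (simp add: card_cartesian_product)
    qed
  qed (use assms k in \<open>auto simp: of_nat_diff algebra_simps\<close>)
qed

section \<open>The even case, the case 4 and the odd case\<close>

theorem theorem2p1:
  fixes n :: nat
  assumes "n \<ge> 3"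
  shows
    "(even n \<and> n > 4 \<longrightarrow>
        graph_spectrum (noncommuting_graph (dihedral_group n)) =
          replicate_mset (n div 2 - 1) (-2) + replicate_mset (3 * n div 2 - 3) 0 +
          replicate_mset 1 (((real n - 2) - sqrt (5 * (real n)\<^sup>2 - 12 * real n + 4)) / 2) +
          replicate_mset 1 (((real n - 2) + sqrt (5 * (real n)\<^sup>2 - 12 * real n + 4)) / 2)) \<and>
     (odd n \<longrightarrow>
        graph_spectrum (noncommuting_graph (dihedral_group n)) =
          replicate_mset (n - 1) (-1) + replicate_mset (n - 2) 0 +
          replicate_mset 1 (((real n - 1) - sqrt (5 * (real n)\<^sup>2 - 6 * real n + 1)) / 2) +
          replicate_mset 1 (((real n - 1) + sqrt (5 * (real n)\<^sup>2 - 6 * real n + 1)) / 2)) \<and>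
     (n = 4 \<longrightarrow>
        graph_spectrum (noncommuting_graph (dihedral_group n)) =
          replicate_mset 2 (-2) + replicate_mset 3 0 + replicate_mset 1 4)"
proof (intro conjI impI)
  \<comment> \<open>Stated for every even \<open>n\<close>, so that it also yields the case
    4.\<close>
  have even: "graph_spectrum (noncommuting_graph (dihedral_group n)) =
      replicate_mset (n div 2 - 1) (-2) + replicate_mset (3 * n div 2 - 3) 0 +
      replicate_mset 1 (((real n - 2) - sqrt (5 * (real n)\<^sup>2 - 12 * real n + 4)) / 2) +
      replicate_mset 1 (((real n - 2) + sqrt (5 * (real n)\<^sup>2 - 12 * real n + 4)) / 2)"
    if "even n"
  proof -
    define S where "S = sqrt (5 * (real n)\<^sup>2 - 12 * real n + 4)"
    \<comment> \<open>The factorization shows that the radicand is nonnegative, so that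
      \<open>S\<close> squares to it.\<close>
    have "5 * (real n)\<^sup>2 - 12 * real n + 4 = (5 * real n - 2) * (real n - 2)"
      by (simp add: algebra_simps power2_eq_square)
    then have S: "S\<^sup>2 = 5 * (real n)\<^sup>2 - 12 * real n + 4"
      using assms by (simp add: S_def)
    obtain k where k: "n = 2 * k"
      using \<open>even n\<close> by (rule evenE)
    have "graph_spectrum (noncommuting_graph (dihedral_group n)) =
      replicate_mset (k - 1) (- real 2) + replicate_mset (n - 2 - 1 + k * (2 - 1)) 0 +
      {#(real n - 2 - S) / 2, (real n - 2 + S) / 2#}"
    proof (rule graph_spectrum_noncommuting_graph_dihedral_group)
      show "(real n - 2 - S) / 2 * ((real n - 2 + S) / 2) = - ((real n - real 2) * real n)"
        using S by (simp add: field_simps power2_eq_square)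
    qed (use assms k in \<open>auto simp: field_simps\<close>)
    moreover have "n - 2 - 1 + k * (2 - 1) = 3 * n div 2 - 3" "k - 1 = n div 2 - 1"
      using k assms by auto
    ultimately show ?thesis
      by (simp add: S_def)
  qed
  then show "even n \<and> n > 4 \<Longrightarrow> graph_spectrum (noncommuting_graph (dihedral_group n)) =
      replicate_mset (n div 2 - 1) (-2) + replicate_mset (3 * n div 2 - 3) 0 +
      replicate_mset 1 (((real n - 2) - sqrt (5 * (real n)\<^sup>2 - 12 * real n + 4)) / 2) +
      replicate_mset 1 (((real n - 2) + sqrt (5 * (real n)\<^sup>2 - 12 * real n + 4)) / 2)"
    by blast
  show "graph_spectrum (noncommuting_graph (dihedral_group n)) =
      replicate_mset 2 (-2) + replicate_mset 3 0 + replicate_mset 1 4" if "n = 4"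
  proof -
    have replicate_2: "replicate_mset 2 y = {#y, y#}" for y :: real
      by (simp add: numeral_2_eq_2)
    \<comment> \<open>The simple eigenvalues become -2 and 4, and the former merges with the
      eigenvalue -2 already present.\<close>
    have "sqrt (5 * (real n)\<^sup>2 - 12 * real n + 4) = 6"
      using that by (simp add: real_sqrt_unique)
    then show ?thesis
      using even that by (simp add: replicate_2)
  qed
  show "graph_spectrum (noncommuting_graph (dihedral_group n)) =
      replicate_mset (n - 1) (-1) + replicate_mset (n - 2) 0 +
      replicate_mset 1 (((real n - 1) - sqrt (5 * (real n)\<^sup>2 - 6 * real n + 1)) / 2) +
      replicate_mset 1 (((real n - 1) + sqrt (5 * (real n)\<^sup>2 - 6 * real n + 1)) / 2)"
    if "odd n"
  proof -
    define S where "S = sqrt (5 * (real n)\<^sup>2 - 6 * real n + 1)"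
    have "5 * (real n)\<^sup>2 - 6 * real n + 1 = (5 * real n - 1) * (real n - 1)"
      by (simp add: algebra_simps power2_eq_square)
    then have S: "S\<^sup>2 = 5 * (real n)\<^sup>2 - 6 * real n + 1"
      using assms by (simp add: S_def)
    have "graph_spectrum (noncommuting_graph (dihedral_group n)) =
      replicate_mset (n - 1) (- real 1) + replicate_mset (n - 1 - 1 + n * (1 - 1)) 0 +
      {#(real n - 1 - S) / 2, (real n - 1 + S) / 2#}"
    proof (rule graph_spectrum_noncommuting_graph_dihedral_group)
      show "(real n - 1 - S) / 2 * ((real n - 1 + S) / 2) = - ((real n - real 1) * real n)"
        using S by (simp add: field_simps power2_eq_square)
      \<comment> \<open>Here \<open>c = 1\<close> and \<open>k = n\<close>: an odd \<open>n\<close>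
        is coprime to 2.\<close>
      show "int n dvd 2 * d \<longleftrightarrow> int n dvd d" for d
        using that by (simp add: coprime_dvd_mult_right_iff)
    qed (use assms in \<open>auto simp: field_simps\<close>)
    moreover have "n - 1 - 1 + n * (1 - 1) = n - 2"
      by simp
    ultimately show ?thesis
      by (simp add: S_def)
  qed
qed

end
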